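(* Let $\mathcal{S}$ be the set of Schur partitions, that is, integer partitions $\lambda=(\lambda_1\ge\cdots\ge\lambda_{\ell(\lambda)})$ such that for all $1\le i<\ell(\lambda)$ one has $\lambda_i-\lambda_{i+1}\ge 3$, with strict inequality if either $\lambda_i$ or $\lambda_{i+1}$ is a multiple of $3$. Let $f_{\mathcal{S}}(x)=f_{\mathcal{S}}(x;q):=\sum_{\lambda\in\mathcal{S}}x^{\ell(\lambda)}q^{|\lambda|}$. Then $$f_{\mathcal{S}}(x)=\sum_{m,n\ge 0}\frac{(-1)^n\,x^{m+2n}\,q^{3n(3n+2m)+\frac{m(3m-1)}{2}}}{(q;q)_m\,(q^6;q^6)_n}.$$
   Context: For an integer partition $\lambda$ with (positive integer) parts $\lambda_1\ge\cdots\ge\lambda_\ell$, its size is $|\lambda|=\lambda_1+\cdots+\lambda_\ell$ and its length is $\ell(\lambda)=\ell$ (the number of parts); the empty partition is allowed, with size and length $0$. For an integer $n\ge 0$, $(a;q)_n=\prod_{k=0}^{n-1}(1-aq^k)$. The identity may be read as an identity of formal power series in $q$ whose coefficients are polynomials in $x$ (equivalently, as an identity of convergent series for complex $x$ and $|q|<1$). *)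

theory Defs
  imports "HOL-Analysis.Analysis"
begin

text \<open>
  A partition is the weakly decreasing list of its positive parts, so its size is
  \<open>sum_list\<close> and its length is \<open>length\<close>; the empty list is the empty partition.
\<close>

definition is_partition :: "nat list \<Rightarrow> bool" where
  "is_partition l \<longleftrightarrow> sorted_wrt (\<ge>) l \<and> (\<forall>p\<in>set l. p > 0)"

text \<open>Differences of parts are written additively to avoid truncated subtraction.\<close>

definition schur_partitions :: "nat list set" where
  "schur_partitions = {l. is_partition l \<and>
     (\<forall>i. Suc i < length l \<longrightarrow>
        l ! i \<ge> l ! Suc i + 3 \<and>
        (3 dvd l ! i \<or> 3 dvd l ! Suc i \<longrightarrow> l ! i > l ! Suc i + 3))}"

definition qpochhammer :: "complex \<Rightarrow> complex \<Rightarrow> nat \<Rightarrow> complex" where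
  "qpochhammer a q n = (\<Prod>k<n. 1 - a * q ^ k)"

text \<open>
  The series is read analytically, for complex \<open>x\<close> and \<open>q\<close> with \<open>norm q < 1\<close>. Since
  \<open>infsum\<close> is \<open>0\<close> on families that are not summable, the theorem also asserts summability.
\<close>

definition schur_gf :: "complex \<Rightarrow> complex \<Rightarrow> complex" where
  "schur_gf x q = (\<Sum>\<^sub>\<infinity>l\<in>schur_partitions. x ^ length l * q ^ sum_list l)"

end

theory Submission
  imports Defs
begin

text \<open>
  Let \<open>f\<^sub>i(x)\<close> be the generating function of the Schur partitions with all parts at least \<open>i\<close>.
  Removing a smallest part \<open>i = 1, 2, 3\<close> and subtracting \<open>3\<close> from all parts gives
  \<open>f\<^sub>1(x) = f\<^sub>2(x) + x q f\<^sub>1(x q^3)\<close>, \<open>f\<^sub>2(x) = f\<^sub>3(x) + x q^2 f\<^sub>2(x q^3)\<close> and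
  \<open>f\<^sub>3(x) = f\<^sub>1(x q^3) + x q^3 f\<^sub>1(x q^6)\<close>, hence
  \<open>f\<^sub>1(x) = (1 + x q + x q^2) f\<^sub>1(x q^3) + x q^3 (1 - x q^3) f\<^sub>1(x q^6)\<close>,
  which determines the coefficients in \<open>x\<close>. Grouping the double series by \<open>N = m + 2 n\<close>, its
  \<open>x^N\<close> coefficient is \<open>q^(N (3 N - 1) / 2)\<close> times the \<open>z^N\<close> coefficient of
  \<open>G(z) = E(z) H(z)\<close>, where \<open>E(z) = 1 / (z; q)\<close> and \<open>H(z) = (z^2 q^4; q^6)\<close> (infinite products,
  expanded by Euler's identities). From \<open>E(z q) = (1 - z) E(z)\<close> and
  \<open>H(z) = (1 - z^2 q^4) H(z q^3)\<close> one gets \<open>(1 - z) (1 - z q) G(z) = (1 + z q^2) G(z q^3)\<close>,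
  which is the same recurrence for the coefficients.
\<close>

section \<open>Schur partitions by length and smallest part\<close>

text \<open>
  If \<open>3\<close> does not divide \<open>i\<close>, it does not divide \<open>i + 3\<close> either, so the least admissible
  difference is determined by the smaller part \<open>i\<close>.
\<close>

definition schur_gap :: "nat \<Rightarrow> nat" where
  "schur_gap i = (if 3 dvd i then 4 else 3)"

lemma schur_gap_add_3: "schur_gap (i + 3) = schur_gap i"
  by (simp add: schur_gap_def)

lemma schur_step_iff:
  "(a \<ge> b + 3 \<and> (3 dvd a \<or> 3 dvd b \<longrightarrow> a > b + 3)) \<longleftrightarrow> a \<ge> b + schur_gap b"
  for a b :: nat
proof -
  have "\<not> 3 dvd b + 3" if "\<not> 3 dvd b"
    using that by presburger
  then show ?thesis
    unfolding schur_gap_def by (cases "a = b + 3") auto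
qed

text \<open>The gap relation is transitive, so the condition on neighbours becomes a
  \<open>sorted_wrt\<close> condition on all pairs, which behaves well under append and
  \<open>map\<close>.\<close>

lemma schur_partitions_eq:
  "schur_partitions =
     {l. sorted_wrt (\<lambda>a b. a \<ge> b + schur_gap b) l \<and> (\<forall>p\<in>set l. p > 0)}"
proof -
  have trans: "transp (\<lambda>a b. a \<ge> b + schur_gap b)"
    by (intro transpI) linarith
  have "sorted_wrt (\<ge>) l" if "sorted_wrt (\<lambda>a b. a \<ge> b + schur_gap b) l" for l
    using that by (rule sorted_wrt_mono_rel [rotated]) auto
  then show ?thesis
    unfolding schur_partitions_def is_partition_def schur_step_iff
      sorted_wrt_iff_nth_Suc_transp[OF trans] by blast
qed

definition schur_level :: "nat \<Rightarrow> nat \<Rightarrow> nat list set" where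
  "schur_level i N = {l \<in> schur_partitions. length l = N \<and> (\<forall>p\<in>set l. i \<le> p)}"

lemma schur_level_0: "schur_level i 0 = {[]}"
  by (auto simp: schur_level_def schur_partitions_eq)

text \<open>The last entry is the smallest part. Either it exceeds \<open>i\<close>, or it equals
  \<open>i\<close> and can be removed, leaving parts that are at least
  \<open>i + schur_gap i\<close>.\<close>

lemma schur_level_Suc:
  assumes "i > 0"
  shows "schur_level i (Suc N) =
    schur_level (Suc i) (Suc N) \<union> (\<lambda>l. l @ [i]) ` schur_level (i + schur_gap i) N"
proof (intro equalityI subsetI)
  fix l assume l: "l \<in> schur_level i (Suc N)"
  then have "l \<noteq> []"
    by (auto simp: schur_level_def)
  then obtain l' j where l_eq: "l = l' @ [j]"
    by (metis rev_exhaust)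
  show "l \<in> schur_level (Suc i) (Suc N) \<union> (\<lambda>l. l @ [i]) ` schur_level (i + schur_gap i) N"
  proof (cases "j = i")
    case True
    then have "l' \<in> schur_level (i + schur_gap i) N"
      using l by (auto simp: l_eq schur_level_def schur_partitions_eq sorted_wrt_append)
    then show ?thesis
      using True l_eq by blast
  next
    case False
    then have "l \<in> schur_level (Suc i) (Suc N)"
      using l
      by (fastforce simp: l_eq schur_level_def schur_partitions_eq sorted_wrt_append)
    then show ?thesis by blast
  qed
next
  fix l
  assume "l \<in> schur_level (Suc i) (Suc N) \<union> (\<lambda>l. l @ [i]) ` schur_level (i + schur_gap i) N"
  then show "l \<in> schur_level i (Suc N)"
    using assms
    by (fastforce simp: schur_level_def schur_partitions_eq sorted_wrt_append)
qed

text \<open>Adding 3 to every part changes neither differences nor divisibility by 3. Conversely,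
  \<open>i > 0\<close> keeps the parts positive when 3 is subtracted.\<close>

lemma schur_level_shift:
  assumes "i > 0"
  shows "schur_level (i + 3) N = map (\<lambda>p. p + 3) ` schur_level i N"
proof (intro equalityI subsetI)
  fix l assume l: "l \<in> schur_level (i + 3) N"
  define l' where "l' = map (\<lambda>p. p - 3) l"
  have ge: "p \<ge> i + 3" if "p \<in> set l" for p
    using l that by (auto simp: schur_level_def)
  have l_eq: "l = map (\<lambda>p. p + 3) l'"
    unfolding l'_def by (auto simp: o_def dest!: ge intro!: map_idI[symmetric])
  have "i \<le> p" if "p \<in> set l'" for p
    using ge[of "p + 3"] that by (simp add: l_eq)
  then have "l' \<in> schur_level i N"
    using l assms unfolding l_eq
    by (force simp: schur_level_def schur_partitions_eq sorted_wrt_map schur_gap_add_3)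
  then show "l \<in> map (\<lambda>p. p + 3) ` schur_level i N"
    using l_eq by blast
next
  fix l assume "l \<in> map (\<lambda>p. p + 3) ` schur_level i N"
  then show "l \<in> schur_level (i + 3) N"
    by (auto simp: schur_level_def schur_partitions_eq sorted_wrt_map schur_gap_add_3)
qed

section \<open>Absolute convergence of the generating function\<close>

lemma sorted_distinct_rev_schur_partition:
  assumes "l \<in> schur_partitions"
  shows "sorted (rev l)" "distinct (rev l)"
proof -
  have "sorted_wrt (>) l"
    using assms unfolding schur_partitions_eq
    by (auto intro: sorted_wrt_mono_rel [rotated] simp: schur_gap_def split: if_splits)
  then show "sorted (rev l)" "distinct (rev l)"
    by (metis sorted_wrt_rev strict_sorted_iff rev_rev_ident)+
qed

lemma inj_on_set_schur_partitions: "inj_on set schur_partitions"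
proof (rule inj_onI)
  fix l m assume l: "l \<in> schur_partitions" and m: "m \<in> schur_partitions" and eq: "set l = set m"
  have "rev l = rev m"
    using l m eq by (intro sorted_distinct_set_unique sorted_distinct_rev_schur_partition) auto
  then show "l = m" by simp
qed

text \<open>A Schur partition is determined by its set of parts, so a finite partial sum is at most
  the expansion of a product of factors 1 + |x| |q|^p. From 1 + t \<le> exp t, this product is at
  most exp(|x| / (1 - |q|)).\<close>

lemma abs_summable_schur:
  fixes x q :: complex
  assumes "norm q < 1"
  shows "(\<lambda>l. norm (x ^ length l * q ^ sum_list l)) summable_on schur_partitions"
proof (rule nonneg_bdd_above_summable_on)
  define w where "w p = norm x * norm q ^ p" for p
  have w_nonneg: "w p \<ge> 0" for p
    by (simp add: w_def)
  have norm_eq: "norm (x ^ length l * q ^ sum_list l) = prod w (set l)"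
    if "l \<in> schur_partitions" for l
  proof -
    have "distinct l"
      using sorted_distinct_rev_schur_partition(2)[OF that] by simp
    moreover have "norm (x ^ length l * q ^ sum_list l) = prod_list (map w l)"
      by (induction l) (simp_all add: w_def norm_mult norm_power power_add mult_ac)
    ultimately show ?thesis
      by (simp add: prod.distinct_set_conv_list)
  qed
  show "bdd_above (sum (\<lambda>l. norm (x ^ length l * q ^ sum_list l)) `
          {F. F \<subseteq> schur_partitions \<and> finite F})"
  proof (rule bdd_aboveI2)
    fix F assume F: "F \<in> {F. F \<subseteq> schur_partitions \<and> finite F}"
    \<comment> \<open>Inserting 0 keeps \<open>Max\<close> meaningful when there are no parts at
      all.\<close>
    define K where "K = Suc (Max (insert 0 (\<Union>l\<in>F. set l)))"
    have fin: "finite (insert 0 (\<Union>l\<in>F. set l))"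
      using F by auto
    have "p \<le> Max (insert 0 (\<Union>l\<in>F. set l))" if "l \<in> F" "p \<in> set l" for l p
      using that by (intro Max_ge fin) auto
    then have sub: "set ` F \<subseteq> Pow {..<K}"
      unfolding K_def by (auto simp: less_Suc_eq_le)
    have "sum (\<lambda>l. norm (x ^ length l * q ^ sum_list l)) F = (\<Sum>l\<in>F. prod w (set l))"
      using F norm_eq by (intro sum.cong) auto
    also have "\<dots> = sum (prod w) (set ` F)"
      using F inj_on_subset[OF inj_on_set_schur_partitions] by (subst sum.reindex) auto
    also have "\<dots> \<le> sum (prod w) (Pow {..<K})"
      using sub by (intro sum_mono2) (auto intro: prod_nonneg w_nonneg)
    also have "\<dots> = (\<Prod>k<K. w k + 1)"
      by (subst prod_add) auto
    also have "\<dots> \<le> (\<Prod>k<K. exp (w k))"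
      using w_nonneg by (intro prod_mono) (auto simp: add.commute intro: exp_ge_add_one_self add_nonneg_nonneg)
    also have "\<dots> = exp (\<Sum>k<K. w k)"
      by (simp add: exp_sum)
    also have "(\<Sum>k<K. w k) \<le> norm x * (1 / (1 - norm q))"
      unfolding w_def sum_distrib_left[symmetric]
      using assms
      by (intro mult_left_mono) (auto simp: sum_gp_strict intro!: divide_right_mono)
    finally show "sum (\<lambda>l. norm (x ^ length l * q ^ sum_list l)) F \<le>
        exp (norm x * (1 / (1 - norm q)))"
      by simp
  qed
qed simp

section \<open>Coefficients of the generating function and their recurrence\<close>

definition schur_coeff :: "complex \<Rightarrow> nat \<Rightarrow> nat \<Rightarrow> complex" where
  "schur_coeff q i N = (\<Sum>\<^sub>\<infinity>l\<in>schur_level i N. q ^ sum_list l)"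

lemma summable_schur_level:
  fixes q :: complex
  assumes "norm q < 1"
  shows "(\<lambda>l. q ^ sum_list l) summable_on schur_level i N"
proof (rule summable_on_subset_banach)
  show "(\<lambda>l. q ^ sum_list l) summable_on schur_partitions"
    using abs_summable_schur[OF assms, of 1] by (auto intro: abs_summable_summable)
qed (auto simp: schur_level_def)

lemma schur_coeff_0: "schur_coeff q i 0 = 1"
  by (simp add: schur_coeff_def schur_level_0)

lemma schur_coeff_Suc:
  assumes "norm q < 1" "i > 0"
  shows "schur_coeff q i (Suc N) =
    schur_coeff q (Suc i) (Suc N) + q ^ i * schur_coeff q (i + schur_gap i) N"
proof -
  let ?f = "\<lambda>l. q ^ sum_list l"
  let ?B = "(\<lambda>l. l @ [i]) ` schur_level (i + schur_gap i) N"
  have sub: "?B \<subseteq> schur_level i (Suc N)"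
    using schur_level_Suc[OF assms(2)] by blast
  have "schur_coeff q i (Suc N) = infsum ?f (schur_level (Suc i) (Suc N)) + infsum ?f ?B"
    unfolding schur_coeff_def schur_level_Suc[OF assms(2)]
    using summable_on_subset_banach[OF summable_schur_level[OF assms(1)] sub]
    by (intro infsum_Un_disjoint summable_schur_level assms) (auto simp: schur_level_def)
  also have "infsum ?f ?B = (\<Sum>\<^sub>\<infinity>l\<in>schur_level (i + schur_gap i) N. q ^ i * q ^ sum_list l)"
    by (subst infsum_reindex) (auto simp: inj_on_def o_def power_add mult_ac)
  also have "\<dots> = q ^ i * schur_coeff q (i + schur_gap i) N"
    unfolding schur_coeff_def by (rule infsum_cmult_right')
  finally show ?thesis
    by (simp add: schur_coeff_def)
qed

lemma schur_coeff_shift: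
  assumes "i > 0"
  shows "schur_coeff q (i + 3) N = q ^ (3 * N) * schur_coeff q i N"
proof -
  have sum: "sum_list (map (\<lambda>p. p + 3) l) = 3 * length l + sum_list l" for l :: "nat list"
    by (induction l) auto
  have "schur_coeff q (i + 3) N = (\<Sum>\<^sub>\<infinity>l\<in>schur_level i N. q ^ sum_list (map (\<lambda>p. p + 3) l))"
    unfolding schur_coeff_def schur_level_shift[OF assms]
    by (subst infsum_reindex) (auto simp: inj_on_def o_def intro: map_injective)
  also have "\<dots> = (\<Sum>\<^sub>\<infinity>l\<in>schur_level i N. q ^ (3 * N) * q ^ sum_list l)"
    by (rule infsum_cong) (auto simp: sum power_add schur_level_def)
  also have "\<dots> = q ^ (3 * N) * schur_coeff q i N"
    unfolding schur_coeff_def by (rule infsum_cmult_right')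
  finally show ?thesis .
qed

text \<open>These are the coefficients of x and x^(N+2) in the functional equation for f_1. The
  system closes because the levels 4, 5 and 7 that arise are shifts of levels 1, 2 and, twice,
  1.\<close>

lemma schur_coeff_rec:
  assumes "norm q < 1"
  shows "(1 - q ^ 3) * schur_coeff q 1 1 = q + q ^ 2 + q ^ 3"
    and "(1 - q ^ (3 * N + 6)) * schur_coeff q 1 (Suc (Suc N)) =
      (q ^ (3 * N + 4) + q ^ (3 * N + 5) + q ^ (6 * N + 9)) * schur_coeff q 1 (Suc N) -
      q ^ (6 * N + 6) * schur_coeff q 1 N"
proof -
  let ?F = "schur_coeff q"
  have shift: "?F 4 M = q ^ (3 * M) * ?F 1 M" "?F 5 M = q ^ (3 * M) * ?F 2 M"
      "?F 7 M = q ^ (3 * M) * (q ^ (3 * M) * ?F 1 M)" for M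
    using schur_coeff_shift[of 1 q M] schur_coeff_shift[of 2 q M] schur_coeff_shift[of 4 q M]
    by simp_all
  have 1: "?F 1 (Suc M) = ?F 2 (Suc M) + q * (q ^ (3 * M) * ?F 1 M)" for M
    using schur_coeff_Suc[OF assms, of 1 M]
    by (simp add: schur_gap_def shift flip: numeral_2_eq_2)
  have 2: "?F 2 (Suc M) = ?F 3 (Suc M) + q ^ 2 * (q ^ (3 * M) * ?F 2 M)" for M
    using schur_coeff_Suc[OF assms, of 2 M]
    by (simp add: schur_gap_def shift flip: numeral_3_eq_3)
  have 3: "?F 3 (Suc M) = q ^ (3 * Suc M) * ?F 1 (Suc M) + q ^ 3 * (q ^ (3 * M) * (q ^ (3 * M) * ?F 1 M))" for M
    using schur_coeff_Suc[OF assms, of 3 M]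
    by (simp add: schur_gap_def shift)
  show "(1 - q ^ 3) * ?F 1 1 = q + q ^ 2 + q ^ 3"
    using 1[of 0] 2[of 0] 3[of 0] by (simp add: schur_coeff_0 algebra_simps)
  define A where "A = q ^ (3 * N)"
  have powers: "q ^ (3 * N) = A" "q ^ (3 * Suc N) = A * q ^ 3" "q ^ (3 * Suc (Suc N)) = A * q ^ 6"
      "q ^ (3 * N + k) = A * q ^ k" "q ^ (6 * N + k) = A ^ 2 * q ^ k" for k
    by (simp_all add: A_def power_add power_mult power_numeral_reduce mult_ac
          flip: power_mult_distrib)
  show "(1 - q ^ (3 * N + 6)) * ?F 1 (Suc (Suc N)) =
      (q ^ (3 * N + 4) + q ^ (3 * N + 5) + q ^ (6 * N + 9)) * ?F 1 (Suc N) -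
      q ^ (6 * N + 6) * ?F 1 N"
    \<comment> \<open>\<open>1[of N]\<close> eliminates the remaining \<open>?F 2 (Suc N)\<close>
      and is the source of the negative term.\<close>
    using 1[of N] 1[of "Suc N"] 2[of "Suc N"] 3[of "Suc N"]
    unfolding powers by algebra
qed

section \<open>Nonvanishing of the denominators\<close>

lemma qpochhammer_Suc: "qpochhammer a q (Suc n) = qpochhammer a q n * (1 - a * q ^ n)"
  by (simp add: qpochhammer_def)

lemma one_minus_power_neq_0:
  fixes q :: complex
  assumes "norm q < 1" "n > 0"
  shows "1 - q ^ n \<noteq> 0"
  using power_less_one_iff[of "norm q" n] assms
  by (metis eq_iff_diff_eq_0 norm_ge_zero norm_one norm_power order_less_irrefl)

lemma qpochhammer_neq_0:
  assumes "norm q < 1"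
  shows "qpochhammer q q n \<noteq> 0"
  using one_minus_power_neq_0[OF assms] by (simp add: qpochhammer_def flip: power_Suc)

lemma norm_power_less_1:
  fixes q :: complex
  assumes "norm q < 1" "k > 0"
  shows "norm (q ^ k) < 1"
  using assms by (simp add: norm_power power_less_one_iff)

section \<open>Formal power series under the substitution z -> c z\<close>

unbundle no vec_syntax
unbundle fps_syntax

definition fps_dilate :: "'a::comm_ring_1 \<Rightarrow> 'a fps \<Rightarrow> 'a fps" where
  "fps_dilate c F = Abs_fps (\<lambda>n. c ^ n * F $ n)"

lemma fps_dilate_nth [simp]: "fps_dilate c F $ n = c ^ n * F $ n"
  by (simp add: fps_dilate_def)

lemma fps_dilate_mult: "fps_dilate c (F * G) = fps_dilate c F * fps_dilate c G"
  for F G :: "'a::comm_ring_1 fps"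
proof (rule fps_ext)
  fix n
  have "c ^ i * F $ i * (c ^ (n - i) * G $ (n - i)) = c ^ n * (F $ i * G $ (n - i))"
    if "i \<in> {0..n}" for i
    using that by (simp add: mult_ac flip: power_add mult.assoc[of "c ^ _" "c ^ _"])
  then show "fps_dilate c (F * G) $ n = (fps_dilate c F * fps_dilate c G) $ n"
    by (simp add: fps_mult_nth sum_distrib_left)
qed

lemma fps_dilate_dilate: "fps_dilate a (fps_dilate b F) = fps_dilate (a * b) F"
  by (simp add: fps_eq_iff power_mult_distrib mult_ac)

definition fps_lin :: "'a::comm_ring_1 \<Rightarrow> 'a fps" where
  "fps_lin c = 1 - fps_const c * fps_X"

lemma fps_dilate_lin: "fps_dilate a (fps_lin c) = fps_lin (a * c)"
  by (auto simp: fps_eq_iff fps_lin_def fps_X_def)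

lemma fps_mult_lin_nth:
  "(F * fps_lin c) $ 0 = F $ 0" "(F * fps_lin c) $ Suc n = F $ Suc n - c * F $ n"
  by (simp_all add: fps_lin_def right_diff_distrib mult.left_commute[of F])

lemma fps_lin_nth: "fps_lin c $ 0 = 1" "fps_lin c $ Suc 0 = - c"
  by (simp_all add: fps_lin_def)

lemma fps_lin_neq_0: "fps_lin c \<noteq> 0"
  by (metis fps_lin_nth(1) fps_zero_nth one_neq_zero)

section \<open>Euler products and the functional equation of G\<close>

text \<open>
  \<open>schur_E\<close>, \<open>schur_H\<close> and \<open>schur_G\<close> are the series \<open>E\<close>, \<open>H\<close> and \<open>G\<close> above, and \<open>fps_lin c\<close>
  is the factor \<open>1 - c z\<close>.
\<close>

definition schur_E :: "complex \<Rightarrow> complex fps" where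
  "schur_E q = Abs_fps (\<lambda>m. 1 / qpochhammer q q m)"

text \<open>The coefficient of z^(2n) in Euler's expansion of H; the exponent is 6 (n choose 2) +
  4n.\<close>

definition schur_h :: "complex \<Rightarrow> nat \<Rightarrow> complex" where
  "schur_h q n = (-1) ^ n * q ^ (3 * n ^ 2 + n) / qpochhammer (q ^ 6) (q ^ 6) n"

definition schur_H :: "complex \<Rightarrow> complex fps" where
  "schur_H q = Abs_fps (\<lambda>k. if even k then schur_h q (k div 2) else 0)"

lemma schur_E_dilate:
  assumes "norm q < 1"
  shows "fps_dilate q (schur_E q) = schur_E q * fps_lin 1"
proof (rule fps_ext)
  fix n
  show "fps_dilate q (schur_E q) $ n = (schur_E q * fps_lin 1) $ n"
  proof (cases n)
    case (Suc m)
    show ?thesis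
      unfolding Suc fps_mult_lin_nth
      using qpochhammer_neq_0[OF assms, of m] one_minus_power_neq_0[OF assms, of "Suc m"]
      by (simp add: schur_E_def qpochhammer_Suc field_simps)
  qed (simp add: fps_lin_def)
qed

lemma schur_h_Suc:
  assumes "norm q < 1"
  shows "schur_h q (Suc n) * (1 - q ^ (6 * Suc n)) = - (q ^ (6 * n + 4)) * schur_h q n"
proof -
  have "norm (q ^ 6) < 1"
    using assms by (rule norm_power_less_1) simp
  note nz = qpochhammer_neq_0[OF this] one_minus_power_neq_0[OF this, of "Suc n"]
  have "3 * (Suc n)\<^sup>2 + Suc n = (6 * n + 4) + (3 * n\<^sup>2 + n)"
    by (simp add: power2_eq_square)
  then have exponent: "q ^ (3 * (Suc n)\<^sup>2 + Suc n) = q ^ (6 * n + 4) * q ^ (3 * n\<^sup>2 + n)"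
    by (metis power_add)
  have "schur_h q (Suc n) * (1 - (q ^ 6) ^ Suc n) = - (q ^ (6 * n + 4)) * schur_h q n"
    unfolding schur_h_def qpochhammer_Suc exponent
    using nz(1)[of n] nz(2) by (simp add: field_simps)
  then show ?thesis
    by (simp only: power_mult)
qed

text \<open>The factor 1 - q^4 z^2 is split into two linear ones, so that one of them can later
  cancel against a factor coming from E. The even coefficients agree by \<open>schur_h_Suc\<close>;
  the odd ones vanish on both sides.\<close>

lemma schur_H_dilate:
  assumes "norm q < 1"
  shows "schur_H q = fps_dilate (q ^ 3) (schur_H q) * (fps_lin (q ^ 2) * fps_lin (- (q ^ 2)))"
proof (rule fps_ext)
  fix n
  have *: "schur_h q (Suc k) = q ^ (6 * k + 6) * schur_h q (Suc k) - q ^ (6 * k + 4) * schur_h q k" for k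
    using schur_h_Suc[OF assms, of k] by (simp add: algebra_simps)
  have "n = 0 \<or> n = 1 \<or> (\<exists>k. n = Suc (Suc (2 * k))) \<or> (\<exists>k. n = Suc (Suc (Suc (2 * k))))"
    by presburger
  then consider "n = 0" | "n = 1" | k where "n = Suc (Suc (2 * k))"
    | k where "n = Suc (Suc (Suc (2 * k)))"
    by blast
  then have "schur_H q $ n =
      (fps_dilate (q ^ 3) (schur_H q) * fps_lin (q ^ 2) * fps_lin (- (q ^ 2))) $ n"
  proof cases
    case 3
    have powers: "(q ^ 3) ^ Suc (Suc (2 * k)) = q ^ (6 * k + 6)"
        "q ^ 2 * (q ^ 2 * (q ^ 3) ^ (2 * k)) = q ^ (6 * k + 4)"
      using power_mult[of q 3 "Suc (Suc (2 * k))"]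
        power_mult[of q 3 "2 * k"] power_add[of q 4 "6 * k"]
      by (simp_all add: add.commute flip: mult.assoc power2_eq_square)
    have "schur_H q $ Suc (Suc (2 * k)) = schur_h q (Suc k)" "schur_H q $ Suc (2 * k) = 0"
        "schur_H q $ (2 * k) = schur_h q k"
      by (simp_all add: schur_H_def)
    then show ?thesis
      unfolding 3 fps_mult_lin_nth fps_dilate_nth powers
      using *[of k] by (simp add: mult.assoc flip: powers(2))
  qed (simp_all add: fps_mult_lin_nth fps_lin_nth schur_H_def)
  then show "schur_H q $ n =
      (fps_dilate (q ^ 3) (schur_H q) * (fps_lin (q ^ 2) * fps_lin (- (q ^ 2)))) $ n"
    by (simp only: mult.assoc)
qed

definition schur_G :: "complex \<Rightarrow> complex fps" where
  "schur_G q = schur_H q * schur_E q"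

text \<open>Passing from E(z) to E(q^3 z) produces the factors 1 - z, 1 - qz and 1 - q^2 z; the last
  also divides the factor 1 - q^4 z^2 of H and is cancelled.\<close>

lemma schur_G_dilate:
  assumes "norm q < 1"
  shows "schur_G q * fps_lin 1 * fps_lin q = fps_dilate (q ^ 3) (schur_G q) * fps_lin (- (q ^ 2))"
proof -
  let ?E = "schur_E q" and ?H = "schur_H q"
  have "fps_dilate (q * (q * q)) ?E = ?E * fps_lin 1 * fps_lin q * fps_lin (q ^ 2)"
    by (simp add: schur_E_dilate[OF assms] fps_dilate_mult fps_dilate_lin power2_eq_square mult_ac
        flip: fps_dilate_dilate)
  then have E: "fps_dilate (q ^ 3) ?E = ?E * fps_lin 1 * fps_lin q * fps_lin (q ^ 2)"
    by (simp add: power3_eq_cube mult_ac)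
  have "schur_G q * fps_lin 1 * fps_lin q * fps_lin (q ^ 2) = ?H * fps_dilate (q ^ 3) ?E"
    by (simp add: schur_G_def E mult_ac)
  also have "\<dots> = fps_dilate (q ^ 3) (schur_G q) * fps_lin (- (q ^ 2)) * fps_lin (q ^ 2)"
    by (subst schur_H_dilate[OF assms]) (simp add: schur_G_def fps_dilate_mult mult_ac)
  finally show ?thesis
    by (simp add: fps_lin_neq_0)
qed

section \<open>Coefficients of G and their recurrence\<close>

definition schur_b :: "complex \<Rightarrow> nat \<Rightarrow> complex" where
  "schur_b q N = (\<Sum>n\<le>N div 2. schur_h q n / qpochhammer q q (N - 2 * n))"

lemma schur_G_nth: "schur_G q $ N = schur_b q N"
proof -
  have "schur_G q $ N = (\<Sum>k\<in>{0..N}. schur_H q $ k * schur_E q $ (N - k))"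
    by (simp add: schur_G_def fps_mult_nth)
  also have "\<dots> = (\<Sum>k\<in>(*) 2 ` {..N div 2}. schur_H q $ k * schur_E q $ (N - k))"
    by (rule sum.mono_neutral_right) (auto simp: schur_H_def elim!: evenE)
  also have "\<dots> = schur_b q N"
    by (subst sum.reindex) (auto simp: inj_on_def schur_b_def schur_H_def schur_E_def)
  finally show ?thesis .
qed

lemma schur_b_rec:
  assumes "norm q < 1"
  shows "schur_b q 0 = 1"
    and "(1 - q ^ 3) * schur_b q 1 = 1 + q + q ^ 2"
    and "(1 - q ^ (3 * N + 6)) * schur_b q (Suc (Suc N)) =
      (1 + q + q ^ (3 * N + 5)) * schur_b q (Suc N) - q * schur_b q N"
proof -
  note nth = arg_cong[OF schur_G_dilate[OF assms], of "\<lambda>F. F $ _"]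
  show 0: "schur_b q 0 = 1"
    by (simp add: schur_b_def schur_h_def qpochhammer_def)
  show "(1 - q ^ 3) * schur_b q 1 = 1 + q + q ^ 2"
    using nth[of 1] unfolding One_nat_def fps_mult_lin_nth
    by (simp add: schur_G_nth 0 algebra_simps)
  show "(1 - q ^ (3 * N + 6)) * schur_b q (Suc (Suc N)) =
      (1 + q + q ^ (3 * N + 5)) * schur_b q (Suc N) - q * schur_b q N"
    using nth[of "Suc (Suc N)"] unfolding fps_mult_lin_nth
    by (simp add: schur_G_nth algebra_simps power_add power_mult
        power_numeral_reduce power_mult_distrib)
qed

section \<open>Pentagonal exponents and comparison of the two recurrences\<close>

text \<open>The division is exact, as the product is always even; at \<open>m = 0\<close> the
  truncated difference is multiplied by 0.\<close>

definition pent :: "nat \<Rightarrow> nat" where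
  "pent m = m * (3 * m - 1) div 2"

lemma pent_0: "pent 0 = 0"
  by (simp add: pent_def)

lemma pent_Suc: "pent (Suc m) = pent m + 3 * m + 1"
proof -
  have "Suc m * (3 * Suc m - 1) = m * (3 * m - 1) + 2 * (3 * m + 1)"
    by (cases m) (simp_all add: algebra_simps)
  then show ?thesis
    unfolding pent_def by (simp del: mult_Suc mult_Suc_right)
qed

text \<open>The factor \<open>q ^ pent N\<close> turns the recurrence for \<open>schur_b\<close>
  into the one for \<open>schur_coeff\<close>. The leading coefficients 1 - q^3 and 1 - q^(3M+6) are
  nonzero, so the recurrence has only one solution with the given start.\<close>

lemma schur_coeff_eq:
  assumes "norm q < 1"
  shows "schur_coeff q 1 N = q ^ pent N * schur_b q N"
proof (induction N rule: less_induct)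
  case (less N)
  have "N = 0 \<or> N = 1 \<or> (\<exists>M. N = Suc (Suc M))"
    by presburger
  then consider "N = 0" | "N = 1" | M where "N = Suc (Suc M)"
    by blast
  then show ?case
  proof cases
    case 1
    then show ?thesis
      by (simp add: schur_coeff_0 schur_b_rec[OF assms] pent_0)
  next
    case 2
    have "(1 - q ^ 3) * schur_coeff q 1 1 = q * ((1 - q ^ 3) * schur_b q 1)"
      unfolding schur_b_rec[OF assms] schur_coeff_rec(1)[OF assms]
      by (simp add: algebra_simps power_numeral_reduce)
    then have "(1 - q ^ 3) * schur_coeff q 1 1 = (1 - q ^ 3) * (q * schur_b q 1)"
      by (simp add: mult_ac)
    then show ?thesis
      using 2 one_minus_power_neq_0[OF assms, of 3] by (simp add: pent_Suc pent_0)
  next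
    case 3
    define A where "A = q ^ (3 * M)"
    have powers: "q ^ (3 * M + k) = A * q ^ k" "q ^ (6 * M + k) = A ^ 2 * q ^ k" for k
      by (simp_all add: A_def power_add power_mult power_numeral_reduce mult_ac
            flip: power_mult_distrib)
    have "pent (Suc M) = pent M + (3 * M + 1)" "pent N = pent M + (6 * M + 5)"
      by (simp_all add: 3 pent_Suc)
    then have pent: "q ^ pent (Suc M) = q ^ pent M * (A * q)"
        "q ^ pent N = q ^ pent M * (A ^ 2 * q ^ 5)"
      by (simp_all only: power_add[of q "pent M"] powers power_one_right)
    have IH: "schur_coeff q 1 M = q ^ pent M * schur_b q M"
        "schur_coeff q 1 (Suc M) = q ^ pent M * (A * q) * schur_b q (Suc M)"
      using less.IH[of M] less.IH[of "Suc M"] 3 pent by auto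
    have "(1 - q ^ (3 * M + 6)) * schur_coeff q 1 N =
        q ^ pent M * (A ^ 2 * q ^ 5) *
          ((1 + q + q ^ (3 * M + 5)) * schur_b q (Suc M) - q * schur_b q M)"
      unfolding 3 schur_coeff_rec(2)[OF assms, of M] IH unfolding powers
      by (simp add: algebra_simps power_numeral_reduce)
    also have "\<dots> = (1 - q ^ (3 * M + 6)) * (q ^ pent N * schur_b q N)"
      unfolding 3 schur_b_rec(3)[OF assms, of M, symmetric] pent(2)[unfolded 3] by (simp only: mult_ac)
    finally have "(1 - q ^ (3 * M + 6)) * schur_coeff q 1 N =
        (1 - q ^ (3 * M + 6)) * (q ^ pent N * schur_b q N)" .
    then show ?thesis
      using one_minus_power_neq_0[OF assms, of "3 * M + 6"] by simp
  qed
qed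

section \<open>Summability of the double series\<close>

text \<open>Ratio test: consecutive terms have ratio at most |y| |q|^m / (1 - |q|), which tends to
  0. The exponent \<open>e\<close> is left general to cover both pentagonal numbers and
  squares.\<close>

lemma summable_qpochhammer_quadratic:
  fixes y q :: complex
  assumes "norm q < 1" and step: "\<And>m. e (Suc m) = e m + d m" "\<And>m. d m \<ge> m"
  shows "summable (\<lambda>m. norm (y ^ m * q ^ e m / qpochhammer q q m))"
proof -
  let ?f = "\<lambda>m. norm (y ^ m * q ^ e m / qpochhammer q q m)"
  let ?r = "\<lambda>m. norm y * norm q ^ m / (1 - norm q)"
  have le: "?f (Suc m) \<le> ?r m * ?f m" for m
  proof -
    have "1 - norm q \<le> 1 - norm q ^ Suc m"
      using assms power_le_one[of "norm q" m] by (simp add: mult_left_le)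
    also have "\<dots> \<le> norm (1 - q * q ^ m)"
      using norm_triangle_ineq2[of 1 "q * q ^ m"] by (simp add: norm_mult norm_power)
    finally have den: "1 - norm q \<le> norm (1 - q * q ^ m)" .
    have "norm q ^ d m \<le> norm q ^ m"
      using assms by (intro power_decreasing) auto
    then have "norm y * norm q ^ d m / norm (1 - q * q ^ m) \<le> ?r m"
      using den assms(1) by (intro frac_le mult_left_mono) auto
    then have "norm y * norm q ^ d m / norm (1 - q * q ^ m) * ?f m \<le> ?r m * ?f m"
      by (rule mult_right_mono) simp
    also have "norm y * norm q ^ d m / norm (1 - q * q ^ m) * ?f m = ?f (Suc m)"
      by (simp add: qpochhammer_Suc step(1) norm_mult norm_divide norm_power power_add mult_ac)
    finally show ?thesis .
  qed
  have "(\<lambda>m. norm q ^ m) \<longlonglongrightarrow> 0"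
    using assms by (intro LIMSEQ_power_zero) simp
  then have "(\<lambda>m. norm y * norm q ^ m / (1 - norm q)) \<longlonglongrightarrow> norm y * 0 / (1 - norm q)"
    by (intro tendsto_intros) (use assms in auto)
  then have "eventually (\<lambda>m. ?r m < 1 / 2) sequentially"
    by (intro order_tendstoD(2)[of _ 0]) auto
  then obtain M where M: "\<And>m. m \<ge> M \<Longrightarrow> ?r m < 1 / 2"
    by (auto simp: eventually_sequentially)
  show ?thesis
  proof (rule summable_ratio_test[of "1 / 2" M])
    fix m assume "m \<ge> M"
    have "?r m * ?f m \<le> 1 / 2 * ?f m"
      using M[OF \<open>m \<ge> M\<close>] by (intro mult_right_mono) auto
    with le[of m] have "?f (Suc m) \<le> 1 / 2 * ?f m"
      by (rule order_trans)
    then show "norm (?f (Suc m)) \<le> 1 / 2 * norm (?f m)"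
      by (simp only: real_norm_def abs_norm_cancel)
  qed simp
qed

lemma summable_on_product_nonneg:
  fixes u v :: "nat \<Rightarrow> real"
  assumes "summable u" "summable v" "\<And>m. u m \<ge> 0" "\<And>n. v n \<ge> 0"
  shows "(\<lambda>(m, n). u m * v n) summable_on UNIV"
proof -
  have u: "u summable_on UNIV" and v: "v summable_on UNIV"
    using assms by (auto intro: summable_nonneg_imp_summable_on)
  have "(\<lambda>(m, n). u m * v n) summable_on (SIGMA m:UNIV. UNIV)"
  proof (rule summable_on_SigmaI)
    show "((\<lambda>n. case (m, n) of (m, n) \<Rightarrow> u m * v n) has_sum u m * infsum v UNIV) UNIV" for m
      using has_sum_cmult_right[OF has_sum_infsum[OF v]] by simp
    show "(\<lambda>m. u m * infsum v UNIV) summable_on UNIV"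
      using u by (rule summable_on_cmult_left)
  qed (use assms in auto)
  then show ?thesis by simp
qed

lemma summable_double_series:
  fixes x q :: complex
  assumes q: "norm q < 1"
  shows "(\<lambda>(m, n). (-1) ^ n * x ^ (m + 2 * n) * q ^ (3 * n * (3 * n + 2 * m) + pent m)
          / (qpochhammer q q m * qpochhammer (q ^ 6) (q ^ 6) n)) summable_on UNIV"
proof -
  let ?u = "\<lambda>m. norm (x ^ m * q ^ pent m / qpochhammer q q m)"
  let ?v = "\<lambda>n. norm ((x ^ 2) ^ n * (q ^ 6) ^ (n ^ 2) / qpochhammer (q ^ 6) (q ^ 6) n)"
  have u: "summable ?u"
    by (rule summable_qpochhammer_quadratic[OF q, where d = "\<lambda>m. 3 * m + 1"]) (simp_all add: pent_Suc)
  have v: "summable ?v"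
    by (rule summable_qpochhammer_quadratic[where d = "\<lambda>n. 2 * n + 1"])
       (use q norm_power_less_1 in \<open>auto simp: power2_eq_square\<close>)
  show ?thesis
  proof (rule abs_summable_summable, rule Infinite_Sum.abs_summable_on_comparison_test')
    show "(\<lambda>(m, n). ?u m * ?v n) summable_on UNIV"
      by (rule summable_on_product_nonneg[OF u v]) auto
    fix z :: "nat \<times> nat"
    obtain m n where z: "z = (m, n)" by fastforce
    \<comment> \<open>Dropping the mixed term bounds the double series by a product of two single
      series; the constant 6 matches the base \<open>q ^ 6\<close> of the second.\<close>
    have "3 * n * (3 * n + 2 * m) \<ge> 6 * n ^ 2"
      by (simp add: power2_eq_square algebra_simps)
    then have "norm q ^ (3 * n * (3 * n + 2 * m)) \<le> norm q ^ (6 * n ^ 2)"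
      using q by (intro power_decreasing) auto
    then have "norm x ^ (m + 2 * n) * norm q ^ pent m
          / (norm (qpochhammer q q m) * norm (qpochhammer (q ^ 6) (q ^ 6) n))
          * norm q ^ (3 * n * (3 * n + 2 * m)) \<le>
        norm x ^ (m + 2 * n) * norm q ^ pent m
          / (norm (qpochhammer q q m) * norm (qpochhammer (q ^ 6) (q ^ 6) n))
          * norm q ^ (6 * n ^ 2)"
      by (rule mult_left_mono) simp
    moreover have "norm x ^ (m + 2 * n) = norm x ^ m * (norm x ^ 2) ^ n"
        "norm q ^ (6 * n ^ 2) = (norm q ^ 6) ^ (n ^ 2)"
      by (simp_all only: power_add power_mult)
    ultimately show "norm (case z of (m, n) \<Rightarrow> (-1) ^ n * x ^ (m + 2 * n) * q ^ (3 * n * (3 * n + 2 * m) + pent m)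
          / (qpochhammer q q m * qpochhammer (q ^ 6) (q ^ 6) n)) \<le> (case z of (m, n) \<Rightarrow> ?u m * ?v n)"
      by (simp add: z norm_mult norm_divide norm_power power_add[of "norm q"] mult_ac)
  qed
qed

section \<open>Regrouping the double series by N = m + 2n\<close>

text \<open>For m = N - 2n the exponent splits into \<open>pent N\<close>, common to all terms with
  the same N, and 3n^2 + n, the exponent in \<open>schur_h\<close>.\<close>

lemma double_series_term:
  assumes "2 * n \<le> N"
  shows "(-1) ^ n * x ^ N * q ^ (3 * n * (3 * n + 2 * (N - 2 * n)) + pent (N - 2 * n))
          / (qpochhammer q q (N - 2 * n) * qpochhammer (q ^ 6) (q ^ 6) n)
       = x ^ N * q ^ pent N * (schur_h q n / qpochhammer q q (N - 2 * n))"
proof -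
  have "3 * n * (3 * n + 2 * m) + pent m = pent (m + 2 * n) + (3 * n ^ 2 + n)" for m
    by (induction m; induction n) (simp_all add: pent_Suc pent_0 power2_eq_square algebra_simps)
  from this[of "N - 2 * n"] show ?thesis
    using assms by (simp add: schur_h_def power_add mult_ac)
qed

theorem theorem1p1:
  fixes x q :: complex
  assumes "norm q < 1"
  shows "(\<lambda>l. x ^ length l * q ^ sum_list l) summable_on schur_partitions \<and>
    ((\<lambda>(m, n). (-1) ^ n * x ^ (m + 2 * n)
          * q ^ (3 * n * (3 * n + 2 * m) + m * (3 * m - 1) div 2)
          / (qpochhammer q q m * qpochhammer (q ^ 6) (q ^ 6) n))
      has_sum schur_gf x q) (UNIV :: (nat \<times> nat) set)"
proof
  show summable: "(\<lambda>l. x ^ length l * q ^ sum_list l) summable_on schur_partitions"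
    using abs_summable_schur[OF assms] by (rule abs_summable_summable)
  let ?c = "\<lambda>N. x ^ N * schur_coeff q 1 N"
  have bij_schur: "bij_betw snd (SIGMA N:UNIV. schur_level 1 N) schur_partitions"
    by (rule bij_betwI[of _ _ _ "\<lambda>l. (length l, l)"])
       (auto simp: schur_level_def schur_partitions_eq Suc_le_eq)
  have schur: "(?c has_sum schur_gf x q) UNIV"
  proof (rule has_sum_SigmaD)
    show "((\<lambda>z. x ^ length (snd z) * q ^ sum_list (snd z)) has_sum schur_gf x q)
            (SIGMA N:UNIV. schur_level 1 N)"
      unfolding has_sum_reindex_bij_betw[OF bij_schur, of "\<lambda>l. x ^ length l * q ^ sum_list l"]
        schur_gf_def
      using summable by (rule has_sum_infsum)
    fix N
    have "((\<lambda>l. x ^ N * q ^ sum_list l) has_sum ?c N) (schur_level 1 N)"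
      unfolding schur_coeff_def
      by (intro has_sum_cmult_right has_sum_infsum summable_schur_level assms)
    then show "((\<lambda>l. x ^ length (snd (N, l)) * q ^ sum_list (snd (N, l))) has_sum ?c N)
        (schur_level 1 N)"
      by (rule has_sum_cong[THEN iffD1, rotated]) (simp add: schur_level_def)
  qed
  let ?a = "\<lambda>(m, n). (-1) ^ n * x ^ (m + 2 * n) * q ^ (3 * n * (3 * n + 2 * m) + pent m)
          / (qpochhammer q q m * qpochhammer (q ^ 6) (q ^ 6) n)"
  let ?g = "\<lambda>(N :: nat, n :: nat). (N - 2 * n, n)"
  \<comment> \<open>The bound \<open>N div 2\<close> makes the subtraction \<open>N - 2 * n\<close>
    exact.\<close>
  have bij: "bij_betw ?g (SIGMA N:UNIV. {..N div 2}) UNIV"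
    by (rule bij_betwI[of _ _ _ "\<lambda>(m, n). (m + 2 * n, n)"]) auto
  have "((\<lambda>z. ?a (?g z)) has_sum schur_gf x q) (SIGMA N:UNIV. {..N div 2})"
  proof (rule has_sum_SigmaI[OF _ schur])
    fix N
    have "(\<Sum>n\<le>N div 2. ?a (?g (N, n))) =
        (\<Sum>n\<le>N div 2. x ^ N * q ^ pent N * (schur_h q n / qpochhammer q q (N - 2 * n)))"
    proof (rule sum.cong[OF refl])
      fix n assume "n \<in> {..N div 2}"
      then have "2 * n \<le> N" by auto
      then show "?a (?g (N, n)) = x ^ N * q ^ pent N * (schur_h q n / qpochhammer q q (N - 2 * n))"
        using double_series_term[of n N x q] by simp
    qed
    also have "\<dots> = ?c N"
      unfolding schur_coeff_eq[OF assms] schur_b_def by (simp add: sum_distrib_left mult_ac)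
    finally have sum_eq: "(\<Sum>n\<le>N div 2. ?a (?g (N, n))) = ?c N" .
    show "((\<lambda>n. ?a (?g (N, n))) has_sum ?c N) {..N div 2}"
      unfolding sum_eq[symmetric] by (rule has_sum_finite) simp
  next
    \<comment> \<open>Convergence of the grouped sums alone would not suffice: the family itself
      must be summable before it may be summed in groups.\<close>
    show "(\<lambda>z. ?a (?g z)) summable_on (SIGMA N:UNIV. {..N div 2})"
      unfolding summable_on_reindex_bij_betw[OF bij, of ?a]
      by (rule summable_double_series[OF assms])
  qed
  from this[unfolded pent_def] show "((\<lambda>(m, n). (-1) ^ n * x ^ (m + 2 * n)
          * q ^ (3 * n * (3 * n + 2 * m) + m * (3 * m - 1) div 2)
          / (qpochhammer q q m * qpochhammer (q ^ 6) (q ^ 6) n))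
      has_sum schur_gf x q) UNIV"
    by (rule has_sum_reindex_bij_betw[OF bij, of ?a, THEN iffD1, unfolded pent_def])
qed

end
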